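(* Let $d\ge 1$, let $\mathcal{A}=\prod_{i=1}^d[a_{\min}^i,a_{\max}^i]$, let $\boldsymbol{\delta}=(\delta^1,\dots,\delta^d)$ with every $\delta^i>0$, let $a_{\text{prev}}\in\mathcal{A}$, and let $u\in\mathbb{R}^d$ be any latent action. Let $a=(a^1,\dots,a^d)$ be the image of $u$ under the DD-SRad mapping with parameters $(a_{\text{prev}},\boldsymbol{\delta},\mathcal{A})$. Then for every $i\in\{1,\dots,d\}$, $$|a^i-a_{\text{prev}}^i|\le\delta^i\quad\text{and}\quad a^i\in[a_{\min}^i,a_{\max}^i]$$ (so that, if $u$ is random, these constraints hold for all $i$ with probability $1$). Furthermore, for every $i$ with $a_{\text{prev}}^i\in(a_{\min}^i,a_{\max}^i)$, both constraints hold with strict inequalities: $|a^i-a_{\text{prev}}^i|<\delta^i$ and $a_{\min}^i<a^i<a_{\max}^i$.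
   Context: Per-dimension effective radius: for $u^i\in\mathbb{R}$ and $a_{\text{prev}}^i\in[a_{\min}^i,a_{\max}^i]$, $$R_{\text{eff}}^i(u^i,a_{\text{prev}}^i)=\begin{cases}\min(\delta^i,\ a_{\max}^i-a_{\text{prev}}^i), & u^i>0,\\ \min(\delta^i,\ a_{\text{prev}}^i-a_{\min}^i), & u^i<0,\\ \delta^i, & u^i=0.\end{cases}$$ DD-SRad mapping: given $u\in\mathbb{R}^d$ and $a_{\text{prev}}\in\mathcal{A}$, the output $a\in\mathbb{R}^d$ is defined coordinatewise by $$a^i=a_{\text{prev}}^i+R_{\text{eff}}^i(u^i,a_{\text{prev}}^i)\cdot\frac{u^i}{\sqrt{1+(u^i)^2}},\qquad i=1,\dots,d.$$ *)

theory Defs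
  imports "HOL-Probability.Probability"
begin

definition R_eff :: "real \<Rightarrow> real \<Rightarrow> real \<Rightarrow> real \<Rightarrow> real \<Rightarrow> real" where
  "R_eff \<delta> a_min a_max u a_prev =
     (if u > 0 then min \<delta> (a_max - a_prev)
      else if u < 0 then min \<delta> (a_prev - a_min)
      else \<delta>)"

text \<open>The action set, i.e. the product of the intervals from \<open>a_min $ i\<close> to \<open>a_max $ i\<close>,
  is \<open>cbox a_min a_max\<close>; the mapping needs only its two corners.\<close>

definition dd_srad ::
  "real ^ 'd \<Rightarrow> real ^ 'd \<Rightarrow> real ^ 'd \<Rightarrow> real ^ 'd \<Rightarrow> real ^ 'd \<Rightarrow> real ^ 'd" where
  "dd_srad a_prev \<delta> a_min a_max u =
     (\<chi> i. a_prev $ i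
        + R_eff (\<delta> $ i) (a_min $ i) (a_max $ i) (u $ i) (a_prev $ i)
          * (u $ i / sqrt (1 + (u $ i)\<^sup>2)))"

end

theory Submission imports Defs begin

text \<open>The mapping acts on each coordinate separately, moving \<open>p = a_prev $ i\<close> by
  \<open>t = r * s\<close>, where \<open>r\<close> is the effective radius and
  \<open>s = u / sqrt (1 + u\<^sup>2)\<close> has the sign of \<open>u\<close> and satisfies
  \<open>\<bar>s\<bar> < 1\<close>. The radius never exceeds \<delta>, nor the distance from
  \<open>p\<close> to the endpoint that \<open>u\<close> points at, so the step can overshoot
  neither; the opposite endpoint is safe because the step moves away from it.
  \<open>R_eff_step_bounds\<close> makes this precise. The bounds hold for every latent action,
  hence surely, and the probabilistic claim follows.\<close>

lemma abs_div_sqrt_one_plus_square_less_one: "\<bar>x / sqrt (1 + x\<^sup>2)\<bar> < (1::real)"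
proof -
  have "\<bar>x\<bar> < sqrt (1 + x\<^sup>2)"
    by (rule real_less_rsqrt) simp
  moreover have "0 < sqrt (1 + x\<^sup>2)"
    by (simp add: add_pos_nonneg)
  ultimately show ?thesis
    by simp
qed

text \<open>Since \<open>\<bar>s\<bar> < 1\<close>, the step is strictly shorter than the radius
  unless the radius is 0, and then there is no step. So the bound by \<delta> is always strict,
  whereas an endpoint is attained when \<open>p\<close> lies on it and \<open>u\<close> points
  outward.\<close>

lemma R_eff_step_bounds:
  fixes \<delta> lo hi u p :: real
  defines "t \<equiv> R_eff \<delta> lo hi u p * (u / sqrt (1 + u\<^sup>2))"
  assumes "\<delta> > 0" "lo \<le> p" "p \<le> hi"
  shows "\<bar>t\<bar> < \<delta>" "lo \<le> p + t" "p + t \<le> hi"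
    and "lo < p \<Longrightarrow> p < hi \<Longrightarrow> lo < p + t \<and> p + t < hi"
proof -
  define s where "s = u / sqrt (1 + u\<^sup>2)"
  define r where "r = R_eff \<delta> lo hi u p"
  have t: "t = r * s"
    by (simp add: t_def r_def s_def)
  have s: "\<bar>s\<bar> < 1"
    unfolding s_def by (rule abs_div_sqrt_one_plus_square_less_one)
  have r: "0 \<le> r" "r \<le> \<delta>"
    using assms by (auto simp: r_def R_eff_def)
  have abs_le: "\<bar>t\<bar> \<le> r" and abs_less: "r > 0 \<Longrightarrow> \<bar>t\<bar> < r"
    using s r mult_left_mono[of "\<bar>s\<bar>" 1 r] mult_strict_left_mono[of "\<bar>s\<bar>" 1 r]
    by (auto simp: t abs_mult)
  show "\<bar>t\<bar> < \<delta>"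
    using abs_le abs_less r assms by (cases "r > 0") auto
  have sgn: "u \<ge> 0 \<Longrightarrow> s \<ge> 0" "u \<le> 0 \<Longrightarrow> s \<le> 0"
    by (auto simp: s_def divide_nonpos_nonneg)
  \<comment> \<open>For each sign of \<open>u\<close>, the radius controls the endpoint ahead, and
    the sign of \<open>t\<close> takes care of the one behind.\<close>
  have pos: "0 \<le> t" "r \<le> hi - p" if "u > 0"
    using that r sgn by (auto simp: t r_def R_eff_def)
  have neg: "t \<le> 0" "r \<le> p - lo" if "u < 0"
    using that r sgn mult_nonneg_nonpos[of r s] by (auto simp: t r_def R_eff_def)
  have zero: "t = 0" if "u = 0"
    using that by (simp add: t s_def)
  consider "u > 0" | "u < 0" | "u = 0"
    by linarith
  then have "lo \<le> p + t \<and> p + t \<le> hi \<and> (lo < p \<longrightarrow> p < hi \<longrightarrow> lo < p + t \<and> p + t < hi)"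
    \<comment> \<open>If \<open>r > 0\<close>, then \<open>\<bar>t\<bar> < r\<close> gives
      strictness at the endpoint ahead; if \<open>r = 0\<close>, then \<open>t = 0\<close> and
      \<open>p\<close> stays where it is.\<close>
    using pos neg zero abs_le abs_less assms(2-4) by cases (cases "r > 0"; auto)+
  then show "lo \<le> p + t" "p + t \<le> hi" "lo < p \<Longrightarrow> p < hi \<Longrightarrow> lo < p + t \<and> p + t < hi"
    by auto
qed

theorem theorem2p4:
  fixes a_min a_max \<delta> a_prev :: "real ^ 'd"
  assumes delta_pos: "\<And>i. \<delta> $ i > 0"
    and a_prev: "a_prev \<in> cbox a_min a_max"
  shows "(\<forall>u. \<forall>i. \<bar>dd_srad a_prev \<delta> a_min a_max u $ i - a_prev $ i\<bar> \<le> \<delta> $ i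
              \<and> dd_srad a_prev \<delta> a_min a_max u $ i \<in> {a_min $ i..a_max $ i})
       \<and> (\<forall>(M :: 'w measure) U. prob_space M \<longrightarrow> U \<in> borel_measurable M \<longrightarrow>
            \<P>(\<omega> in M. \<forall>i. \<bar>dd_srad a_prev \<delta> a_min a_max (U \<omega>) $ i - a_prev $ i\<bar> \<le> \<delta> $ i
              \<and> dd_srad a_prev \<delta> a_min a_max (U \<omega>) $ i \<in> {a_min $ i..a_max $ i}) = 1)
       \<and> (\<forall>u. \<forall>i. a_prev $ i \<in> {a_min $ i<..<a_max $ i} \<longrightarrow>
            \<bar>dd_srad a_prev \<delta> a_min a_max u $ i - a_prev $ i\<bar> < \<delta> $ i
              \<and> a_min $ i < dd_srad a_prev \<delta> a_min a_max u $ i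
              \<and> dd_srad a_prev \<delta> a_min a_max u $ i < a_max $ i)"
proof -
  have box: "a_min $ i \<le> a_prev $ i" "a_prev $ i \<le> a_max $ i" for i
    using a_prev by (auto simp: mem_box_cart)
  have bounds: "\<bar>dd_srad a_prev \<delta> a_min a_max u $ i - a_prev $ i\<bar> \<le> \<delta> $ i
      \<and> dd_srad a_prev \<delta> a_min a_max u $ i \<in> {a_min $ i..a_max $ i}" for u i
    using R_eff_step_bounds(1-3)[OF delta_pos[of i] box[of i], of "u $ i"] by (simp add: dd_srad_def)
  have strict: "\<bar>dd_srad a_prev \<delta> a_min a_max u $ i - a_prev $ i\<bar> < \<delta> $ i
      \<and> a_min $ i < dd_srad a_prev \<delta> a_min a_max u $ i
      \<and> dd_srad a_prev \<delta> a_min a_max u $ i < a_max $ i"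
    if "a_prev $ i \<in> {a_min $ i<..<a_max $ i}" for u i
    using R_eff_step_bounds(1,4)[OF delta_pos[of i] box[of i], of "u $ i"] that by (simp add: dd_srad_def)
  show ?thesis
    \<comment> \<open>By \<open>bounds\<close> the event is all of \<open>space M\<close>, which has
      probability 1.\<close>
    by (intro conjI allI impI strict) (use bounds in \<open>simp_all add: prob_space.prob_space\<close>)
qed

end
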